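(* Let $X\subset\mathbb P^n_{\mathbf w}$ be a weighted hypersurface over $\mathbb F_q$ with stack $\mathfrak X$, let $r\ge1$ with $X(\mathbb F_{q^r})\neq\varnothing$, and let $p_r$ be the mass measure on $\pi_0(\mathfrak X(\mathbb F_{q^r}))$ normalized to total mass one. For a twist $\xi$ lying over $\mathbf x\in X(\mathbb F_{q^r})$, $$H^{\mathrm{prob}}_{\mathbf w,q}(\mathbf x)=-\log p_r(\xi)=\log\#^{\mathrm{stack}}(\mathfrak X(\mathbb F_{q^r}))+\log|\mathrm{Aut}(\xi)(\mathbb F_{q^r})|.$$
   Context: $q$ is a prime power; $\mathbf w=(w_0,\dots,w_n)$ positive integers; $\mathbb G_m$ acts on $\mathbb A^{n+1}\setminus\{0\}$ by $\lambda\cdot(x_i)=(\lambda^{w_i}x_i)$; $\mathbb P^n_{\mathbf w}$ is the weighted projective space. $X=V(f)$ with $f$ weighted homogeneous over $\mathbb F_q$, affine cone $\hat X=\{f=0\}\subset\mathbb A^{n+1}$, stack $\mathfrak X=[(\hat X\setminus\{0\})/\mathbb G_m]$ with coarse space $X$. $\pi_0(\mathfrak X(\mathbb F_{q^r}))$ is the set of isomorphism classes ("twists") of the groupoid $\mathfrak X(\mathbb F_{q^r})$, i.e. of $\mathbb F_{q^r}^\times$-orbits on $\hat X(\mathbb F_{q^r})\setminus\{0\}$; $\mathrm{Aut}(\xi)(\mathbb F_{q^r})$ is the stabilizer in $\mathbb F_{q^r}^\times$ of a vector in the orbit. The mass of a set $\mathcal S$ of twists is $\#^{\mathrm{stack}}(\mathcal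 S)=\sum_{\xi\in\mathcal S}1/|\mathrm{Aut}(\xi)(\mathbb F_{q^r})|$, and $\#^{\mathrm{stack}}(\mathfrak X(\mathbb F_{q^r}))$ is the mass of all twists. The probabilistic weighted height of $\mathbf x\in X(\mathbb F_{q^r})$ is $H^{\mathrm{prob}}_{\mathbf w,q}(\mathbf x)=-\log\bigl(|\mathbb F_{q^r}^\times\cdot\tilde{\mathbf x}|/|\hat X(\mathbb F_{q^r})\setminus\{0\}|\bigr)$, where $\tilde{\mathbf x}\in\hat X(\mathbb F_{q^r})\setminus\{0\}$ is any representative of $\mathbf x$ and the orbit is taken under the weighted action. *)

theory Defs
  imports
    "HOL-Analysis.Analysis"
    "HOL-Library.Poly_Mapping"
    "HOL-Algebra.Algebraic_Closure_Type"
begin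

text \<open>
  The base field \<open>\<bbbF>\<^sub>q\<close> is a finite field type \<open>'k\<close>, so \<open>q = CARD('k)\<close>, and every extension of it
  is taken inside \<open>'k alg_closure\<close>.  The finite type \<open>'n\<close> indexes the \<open>n + 1\<close> homogeneous
  coordinates.  Polynomials in these coordinates are finitely supported maps from exponent
  vectors to coefficients.  The field with \<open>q\<^sup>r\<close> elements is \<open>ext_field r\<close>, the set of roots
  of \<open>T^(q\<^sup>r) - T\<close>.  A parameter \<open>K\<close> below is a field of scalars: \<open>ext_field r\<close>, or \<open>UNIV\<close> for the
  algebraic closure.
\<close>

type_synonym ('n, 'k) mpoly = "('n \<Rightarrow>\<^sub>0 nat) \<Rightarrow>\<^sub>0 'k"

definition frob :: "nat \<Rightarrow> 'k::{field,finite} alg_closure \<Rightarrow> 'k alg_closure" where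
  "frob r a = a ^ (CARD('k) ^ r)"

definition ext_field :: "nat \<Rightarrow> 'k::{field,finite} alg_closure set" where
  "ext_field r = {a. frob r a = a}"

definition weighted_homogeneous ::
    "('n::finite \<Rightarrow> nat) \<Rightarrow> nat \<Rightarrow> ('n, 'k::zero) mpoly \<Rightarrow> bool" where
  "weighted_homogeneous w d f \<longleftrightarrow>
     (\<forall>m \<in> Poly_Mapping.keys f. (\<Sum>i\<in>UNIV. w i * Poly_Mapping.lookup m i) = d)"

definition eval_mpoly ::
    "('n::finite, 'k::field) mpoly \<Rightarrow> 'k alg_closure ^ 'n \<Rightarrow> 'k alg_closure" where
  "eval_mpoly f v =
     (\<Sum>m \<in> Poly_Mapping.keys f.
        to_ac (Poly_Mapping.lookup f m) * (\<Prod>i\<in>UNIV. (v $ i) ^ Poly_Mapping.lookup m i))"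

definition punctured_cone ::
    "('n::finite, 'k::field) mpoly \<Rightarrow> 'k alg_closure set \<Rightarrow> ('k alg_closure ^ 'n) set" where
  "punctured_cone f K = {v. (\<forall>i. v $ i \<in> K) \<and> v \<noteq> 0 \<and> eval_mpoly f v = 0}"

definition weighted_act :: "('n::finite \<Rightarrow> nat) \<Rightarrow> 'a::field \<Rightarrow> 'a ^ 'n \<Rightarrow> 'a ^ 'n" where
  "weighted_act w t v = (\<chi> i. t ^ w i * v $ i)"

definition weighted_orbit ::
    "('n::finite \<Rightarrow> nat) \<Rightarrow> 'a::field set \<Rightarrow> 'a ^ 'n \<Rightarrow> ('a ^ 'n) set" where
  "weighted_orbit w K v = (\<lambda>t. weighted_act w t v) ` (K - {0})"

definition weighted_stabilizer ::
    "('n::finite \<Rightarrow> nat) \<Rightarrow> 'a::field set \<Rightarrow> 'a ^ 'n \<Rightarrow> 'a set" where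
  "weighted_stabilizer w K v = {t \<in> K - {0}. weighted_act w t v = v}"


definition twists ::
    "('n::finite \<Rightarrow> nat) \<Rightarrow> ('n, 'k::{field,finite}) mpoly \<Rightarrow> nat \<Rightarrow> ('k alg_closure ^ 'n) set set"
  where
  "twists w f r = weighted_orbit w (ext_field r) ` punctured_cone f (ext_field r)"

text \<open>The group acting is commutative, so the choice of the vector in the orbit is immaterial.\<close>

definition twist_Aut ::
    "('n::finite \<Rightarrow> nat) \<Rightarrow> nat \<Rightarrow> ('k::{field,finite} alg_closure ^ 'n) set \<Rightarrow> 'k alg_closure set"
  where
  "twist_Aut w r \<xi> = weighted_stabilizer w (ext_field r) (SOME v. v \<in> \<xi>)"

definition mass ::
    "('n::finite \<Rightarrow> nat) \<Rightarrow> nat \<Rightarrow> ('k::{field,finite} alg_closure ^ 'n) set set \<Rightarrow> real" where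
  "mass w r S = (\<Sum>\<xi>\<in>S. 1 / real (card (twist_Aut w r \<xi>)))"

definition stack_count ::
    "('n::finite \<Rightarrow> nat) \<Rightarrow> ('n, 'k::{field,finite}) mpoly \<Rightarrow> nat \<Rightarrow> real" where
  "stack_count w f r = mass w r (twists w f r)"

definition mass_measure ::
    "('n::finite \<Rightarrow> nat) \<Rightarrow> ('n, 'k::{field,finite}) mpoly \<Rightarrow> nat
      \<Rightarrow> ('k alg_closure ^ 'n) set measure" where
  "mass_measure w f r = point_measure (twists w f r) (\<lambda>\<xi>. ennreal (mass w r {\<xi>}))"

text \<open>
  \<^const>\<open>uniform_measure\<close> \<open>M A\<close> is \<open>M\<close> restricted to \<open>A\<close> and divided by \<open>M(A)\<close>; with \<open>A\<close> the
  whole space it is \<open>M\<close> normalized to total mass one.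
\<close>

definition normalized_mass ::
    "('n::finite \<Rightarrow> nat) \<Rightarrow> ('n, 'k::{field,finite}) mpoly \<Rightarrow> nat
      \<Rightarrow> ('k alg_closure ^ 'n) set measure" where
  "normalized_mass w f r = uniform_measure (mass_measure w f r) (twists w f r)"


text \<open>
  A geometric point of the coarse space \<open>X\<close> is an orbit over the algebraic closure.  As finite
  fields are perfect, the points of \<open>X\<close> over the field with \<open>q\<^sup>r\<close> elements are the geometric
  points fixed by its Frobenius.  One such point may contain several orbits over the finite
  field; these are the twists lying over it.
\<close>

definition coarse_points ::
    "('n::finite \<Rightarrow> nat) \<Rightarrow> ('n, 'k::{field,finite}) mpoly \<Rightarrow> nat \<Rightarrow> ('k alg_closure ^ 'n) set set"
  where
  "coarse_points w f r =
     {x \<in> weighted_orbit w UNIV ` punctured_cone f UNIV. (\<lambda>v. \<chi> i. frob r (v $ i)) ` x = x}"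

definition lies_over :: "('a::field ^ 'n) set \<Rightarrow> ('a ^ 'n) set \<Rightarrow> bool" where
  "lies_over \<xi> x \<longleftrightarrow> \<xi> \<subseteq> x"

text \<open>
  The definite description expresses that any representative over the finite field may be used:
  it denotes the common value at all of them.
\<close>

definition prob_height ::
    "('n::finite \<Rightarrow> nat) \<Rightarrow> ('n, 'k::{field,finite}) mpoly \<Rightarrow> nat
      \<Rightarrow> ('k alg_closure ^ 'n) set \<Rightarrow> real" where
  "prob_height w f r x =
     (THE h. \<forall>v \<in> x \<inter> punctured_cone f (ext_field r).
        h = - ln (real (card (weighted_orbit w (ext_field r) v)) /
                  real (card (punctured_cone f (ext_field r)))))"

end

theory Submission
  imports Defs
begin

text \<open>
  Write \<open>K\<close> for the field with \<open>q\<^sup>r\<close> elements.  The orbit-stabilizer relation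
  \<open>|K\<^sup>\<times>| = |K\<^sup>\<times>\<cdot>v| |Stab(v)|\<close> turns the weight \<open>1/|Aut(\<xi>)|\<close> of a twist into
  \<open>|\<xi>|/|K\<^sup>\<times>|\<close>: up to one constant, mass counts the vectors in an orbit.  As the orbits
  partition the punctured cone \<open>C\<close>, the total mass is \<open>|C|/|K\<^sup>\<times>|\<close>
  (\<open>total_mass\<close>), so \<open>p\<^sub>r(\<xi>) = |\<xi>|/|C|\<close>, and both equalities are logarithms of this identity.

  What remains is that the height depends on the coarse point alone.  Two representatives of the
  same geometric point need not lie in the same \<open>K\<^sup>\<times>\<close>-orbit, but they differ by a
  scalar \<open>t\<close> of the algebraic closure.  The torus is commutative, so translation by \<open>t\<close> does not
  change the stabilizer in \<open>K\<^sup>\<times>\<close>; by orbit-stabilizer the orbits have the same size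
  (\<open>card_weighted_orbit_translate\<close>).
\<close>

section \<open>Orbits and stabilizers of the weighted action\<close>

lemma weighted_act_mult: "weighted_act w s (weighted_act w t v) = weighted_act w (s * t) v"
  by (simp add: weighted_act_def vec_eq_iff power_mult_distrib)

lemma weighted_act_one [simp]: "weighted_act w 1 v = v"
  by (simp add: weighted_act_def vec_eq_iff)

lemma weighted_act_commute:
  "weighted_act w s (weighted_act w t v) = weighted_act w t (weighted_act w s v)"
  by (simp add: weighted_act_mult mult.commute)

lemma weighted_act_inverse:
  "t \<noteq> 0 \<Longrightarrow> weighted_act w (inverse t) (weighted_act w t v) = v"
  by (simp add: weighted_act_mult)

lemma weighted_act_inj:
  assumes "t \<noteq> 0"
  shows "weighted_act w t u = weighted_act w t v \<longleftrightarrow> u = v"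
  using weighted_act_inverse[OF assms] by metis

text \<open>
  Translation by \<open>t\<close> is injective and commutes with the action of \<open>K\<close>.  The scalar \<open>t\<close> may lie
  outside \<open>K\<close>, as happens when two representatives of one geometric point are compared.
\<close>

lemma weighted_stabilizer_translate:
  assumes "t \<noteq> 0"
  shows "weighted_stabilizer w K (weighted_act w t v) = weighted_stabilizer w K v"
  by (auto simp: weighted_stabilizer_def weighted_act_commute[of w _ t]
      weighted_act_inj[OF assms])

text \<open>
  The finite field acts through its multiplicative group, so \<open>K\<close> is described by the closure
  properties that make \<open>K - {0}\<close> a finite group.
\<close>

locale finite_scalars =
  fixes K :: "'a::field set"
  assumes finite_K: "finite K"
    and one_in: "1 \<in> K"
    and mult_in: "s \<in> K \<Longrightarrow> t \<in> K \<Longrightarrow> s * t \<in> K"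
    and inverse_in: "t \<in> K \<Longrightarrow> inverse t \<in> K"
begin

lemma card_units_pos: "card (K - {0}) > 0"
  using finite_K one_in by (auto simp: card_gt_0_iff)

lemma self_in_weighted_orbit: "v \<in> weighted_orbit w K v"
  using one_in unfolding weighted_orbit_def by (force intro: image_eqI[of _ _ 1])

lemma finite_weighted_orbit: "finite (weighted_orbit w K v)"
  using finite_K by (simp add: weighted_orbit_def)

lemma weighted_orbit_subset:
  assumes "u \<in> weighted_orbit w K v"
  shows "weighted_orbit w K u \<subseteq> weighted_orbit w K v"
  using assms mult_in by (auto simp: weighted_orbit_def weighted_act_mult intro!: imageI)

lemma weighted_orbit_sym:
  assumes "u \<in> weighted_orbit w K v"
  shows "v \<in> weighted_orbit w K u"
proof -
  obtain t where t: "t \<in> K" "t \<noteq> 0" "u = weighted_act w t v"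
    using assms by (auto simp: weighted_orbit_def)
  have "v = weighted_act w (inverse t) u"
    using t by (simp add: weighted_act_inverse)
  then show ?thesis
    using t inverse_in by (auto simp: weighted_orbit_def)
qed

lemma weighted_orbit_eq:
  "u \<in> weighted_orbit w K v \<Longrightarrow> weighted_orbit w K u = weighted_orbit w K v"
  using weighted_orbit_subset weighted_orbit_sym by blast

lemma weighted_stabilizer_orbit:
  "u \<in> weighted_orbit w K v \<Longrightarrow> weighted_stabilizer w K u = weighted_stabilizer w K v"
  by (auto simp: weighted_orbit_def weighted_stabilizer_translate)

lemma card_weighted_stabilizer_pos: "card (weighted_stabilizer w K v) > 0"
  using finite_K one_in by (auto simp: card_gt_0_iff weighted_stabilizer_def)

lemma card_weighted_orbit_pos: "card (weighted_orbit w K v) > 0"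
  unfolding card_gt_0_iff using finite_weighted_orbit self_in_weighted_orbit by blast

text \<open>
  The fibre of \<open>t \<mapsto> t\<cdot>v\<close> over \<open>s\<cdot>v\<close> is the coset of the stabilizer through \<open>s\<close>, so all
  fibres of the map from the scalar group onto the orbit have the size of the stabilizer.
\<close>

lemma orbit_stabilizer:
  "card (weighted_orbit w K v) * card (weighted_stabilizer w K v) = card (K - {0})"
proof -
  let ?G = "K - {0}"
  let ?act = "\<lambda>t. weighted_act w t v"
  have fibre: "card {t \<in> ?G. ?act t = y} = card (weighted_stabilizer w K v)"
    if y_in: "y \<in> weighted_orbit w K v" for y
  proof -
    obtain s where s: "s \<in> K" "s \<noteq> 0" and y: "y = ?act s"
      using y_in by (auto simp: weighted_orbit_def)
    have "bij_betw ((*) s) (weighted_stabilizer w K v) {t \<in> ?G. ?act t = y}"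
    proof (rule bij_betw_byWitness[where f' = "(*) (inverse s)"])
      show "(*) s ` weighted_stabilizer w K v \<subseteq> {t \<in> ?G. ?act t = y}"
        using s mult_in
        by (auto simp: weighted_stabilizer_def y weighted_act_mult[symmetric])
      show "(*) (inverse s) ` {t \<in> ?G. ?act t = y} \<subseteq> weighted_stabilizer w K v"
        using s mult_in inverse_in
        by (auto simp: weighted_stabilizer_def y weighted_act_mult[symmetric]
            weighted_act_inverse)
    qed (use s in auto)
    then show ?thesis
      using bij_betw_same_card by fastforce
  qed
  have "card ?G = (\<Sum>y\<in>?act ` ?G. card {t \<in> ?G. ?act t = y})"
    using sum.image_gen[of ?G "\<lambda>_. 1::nat" ?act] finite_K by simp
  also have "\<dots> = (\<Sum>y\<in>weighted_orbit w K v. card (weighted_stabilizer w K v))"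
    using fibre by (intro sum.cong) (auto simp: weighted_orbit_def)
  finally show ?thesis
    by simp
qed

lemma card_weighted_orbit_translate:
  assumes "t \<noteq> 0"
  shows "card (weighted_orbit w K (weighted_act w t v)) = card (weighted_orbit w K v)"
proof -
  have "card (weighted_orbit w K (weighted_act w t v)) * card (weighted_stabilizer w K v)
      = card (weighted_orbit w K v) * card (weighted_stabilizer w K v)"
    using orbit_stabilizer[of w "weighted_act w t v"] orbit_stabilizer[of w v]
    by (simp add: weighted_stabilizer_translate[OF assms])
  then show ?thesis
    using card_weighted_stabilizer_pos[of w v] by simp
qed

lemma sum_card_weighted_orbits:
  assumes "finite C"
    and stable: "\<And>v. v \<in> C \<Longrightarrow> weighted_orbit w K v \<subseteq> C"
  shows "(\<Sum>\<xi>\<in>weighted_orbit w K ` C. card \<xi>) = card C"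
proof -
  have "\<Union>(weighted_orbit w K ` C) = C"
    using stable self_in_weighted_orbit by blast
  moreover have "card (\<Union>(weighted_orbit w K ` C)) = (\<Sum>\<xi>\<in>weighted_orbit w K ` C. card \<xi>)"
  proof (rule card_Union_disjoint)
    show "pairwise disjnt (weighted_orbit w K ` C)"
      unfolding pairwise_def disjnt_iff using weighted_orbit_eq by blast
  qed (use finite_weighted_orbit in auto)
  ultimately show ?thesis
    by simp
qed

end

section \<open>Points of the cone over a finite field\<close>

lemma finite_power_fixed_points:
  assumes "n > 1"
  shows "finite {a :: 'a::idom. a ^ n = a}"
proof -
  let ?p = "Polynomial.monom 1 n - Polynomial.monom 1 1 :: 'a poly"
  have "Polynomial.coeff ?p n = 1"
    using assms by simp
  then have "?p \<noteq> 0"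
    by (metis coeff_0 zero_neq_one)
  then have "finite {a. poly ?p a = 0}"
    by (rule poly_roots_finite)
  then show ?thesis
    by (simp add: poly_monom)
qed

text \<open>
  For \<open>r = 0\<close> the equation \<open>a\<^sup>1 = a\<close> has the whole algebraic closure as solutions; finiteness
  needs the exponent \<open>q\<^sup>r\<close> to exceed one.
\<close>

lemma finite_scalars_ext_field:
  assumes "r \<ge> 1"
  shows "finite_scalars (ext_field r :: 'k::{field,finite} alg_closure set)"
proof
  have "card {0, 1 :: 'k} \<le> CARD('k)"
    by (rule card_mono) auto
  then have "CARD('k) > 1"
    by simp
  then have "CARD('k) ^ r > 1"
    using assms by (intro one_less_power) auto
  then show "finite (ext_field r :: 'k alg_closure set)"
    unfolding ext_field_def frob_def by (rule finite_power_fixed_points)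
qed (auto simp: ext_field_def frob_def power_mult_distrib power_inverse)

lemma finite_vectors_over:
  assumes "finite K"
  shows "finite {v :: 'a ^ 'n::finite. \<forall>i. v $ i \<in> K}"
proof -
  have "{v :: 'a ^ 'n. \<forall>i. v $ i \<in> K} \<subseteq> vec_lambda ` (UNIV \<rightarrow>\<^sub>E K)"
  proof
    fix v :: "'a ^ 'n"
    assume "v \<in> {v. \<forall>i. v $ i \<in> K}"
    then show "v \<in> vec_lambda ` (UNIV \<rightarrow>\<^sub>E K)"
      by (intro image_eqI[of _ _ "vec_nth v"]) auto
  qed
  moreover have "finite ((UNIV :: 'n set) \<rightarrow>\<^sub>E K)"
    using assms by (intro finite_PiE) auto
  ultimately show ?thesis
    using finite_subset by blast
qed

lemma finite_punctured_cone: "finite K \<Longrightarrow> finite (punctured_cone f K)"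
  by (rule finite_subset[OF _ finite_vectors_over[of K]]) (auto simp: punctured_cone_def)

text \<open>Each monomial of weighted degree \<open>d\<close> is scaled by \<open>t\<^sup>d\<close>.\<close>

lemma eval_mpoly_weighted_act:
  assumes "weighted_homogeneous w d f"
  shows "eval_mpoly f (weighted_act w t v) = t ^ d * eval_mpoly f v"
proof -
  have "(\<Prod>i\<in>UNIV. (weighted_act w t v $ i) ^ Poly_Mapping.lookup m i)
      = t ^ d * (\<Prod>i\<in>UNIV. (v $ i) ^ Poly_Mapping.lookup m i)"
    if "m \<in> Poly_Mapping.keys f" for m
    using assms that
    by (auto simp: weighted_act_def weighted_homogeneous_def power_mult_distrib
        prod.distrib power_mult[symmetric] power_sum[symmetric])
  then show ?thesis
    by (simp add: eval_mpoly_def sum_distrib_left mult_ac)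
qed

lemma weighted_orbit_subset_punctured_cone:
  assumes "finite_scalars K" and "weighted_homogeneous w d f" and "v \<in> punctured_cone f K"
  shows "weighted_orbit w K v \<subseteq> punctured_cone f K"
proof
  interpret finite_scalars K by fact
  fix u
  assume "u \<in> weighted_orbit w K v"
  then obtain t where t: "t \<in> K" "t \<noteq> 0" and u: "u = weighted_act w t v"
    by (auto simp: weighted_orbit_def)
  have pow: "t ^ m \<in> K" for m
    by (induction m) (use t one_in mult_in in auto)
  have "u $ i \<in> K" for i
    using assms(3) pow mult_in by (simp add: u weighted_act_def punctured_cone_def)
  moreover have "u \<noteq> 0"
  proof
    assume "u = 0"
    then have "v = 0"
      using t by (simp add: u weighted_act_def vec_eq_iff)
    then show False
      using assms(3) by (simp add: punctured_cone_def)
  qed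
  moreover have "eval_mpoly f u = 0"
    using assms(3) by (simp add: u eval_mpoly_weighted_act[OF assms(2)] punctured_cone_def)
  ultimately show "u \<in> punctured_cone f K"
    by (simp add: punctured_cone_def)
qed

section \<open>Masses of twists\<close>

lemma twist_Aut_weighted_orbit:
  assumes "r \<ge> 1"
  shows "twist_Aut w r (weighted_orbit w (ext_field r) v)
    = weighted_stabilizer w (ext_field r) v"
proof -
  interpret finite_scalars "ext_field r"
    using assms by (rule finite_scalars_ext_field)
  show ?thesis
    unfolding twist_Aut_def
    by (rule weighted_stabilizer_orbit, rule someI, rule self_in_weighted_orbit)
qed

lemma card_twist:
  fixes f :: "('n::finite, 'k::{field,finite}) mpoly"
  assumes "r \<ge> 1" and "\<xi> \<in> twists w f r"
  shows "card \<xi> * card (twist_Aut w r \<xi>) = card (ext_field r - {0} :: 'k alg_closure set)"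
proof -
  interpret finite_scalars "ext_field r :: 'k alg_closure set"
    using assms(1) by (rule finite_scalars_ext_field)
  show ?thesis
    using assms by (auto simp: twists_def twist_Aut_weighted_orbit orbit_stabilizer)
qed

lemma card_twist_Aut_pos:
  fixes f :: "('n::finite, 'k::{field,finite}) mpoly"
  assumes "r \<ge> 1" and "\<xi> \<in> twists w f r"
  shows "card (twist_Aut w r \<xi>) > 0"
proof -
  interpret finite_scalars "ext_field r :: 'k alg_closure set"
    using assms(1) by (rule finite_scalars_ext_field)
  show ?thesis
    using card_twist[OF assms] card_units_pos by (metis gr0I mult_0_right not_less0)
qed

lemma mass_twist:
  fixes f :: "('n::finite, 'k::{field,finite}) mpoly"
  assumes "r \<ge> 1" and "\<xi> \<in> twists w f r"
  shows "1 / real (card (twist_Aut w r \<xi>))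
    = real (card \<xi>) / real (card (ext_field r - {0} :: 'k alg_closure set))"
proof -
  interpret finite_scalars "ext_field r :: 'k alg_closure set"
    using assms(1) by (rule finite_scalars_ext_field)
  show ?thesis
    using card_twist_Aut_pos[OF assms] card_units_pos card_twist[OF assms]
    by (simp add: field_simps flip: of_nat_mult)
qed

lemma finite_twists:
  fixes f :: "('n::finite, 'k::{field,finite}) mpoly"
  assumes "r \<ge> 1"
  shows "finite (twists w f r)"
  unfolding twists_def
  using finite_scalars.finite_K[OF finite_scalars_ext_field[OF assms]]
  by (intro finite_imageI finite_punctured_cone)

lemma total_mass:
  fixes f :: "('n::finite, 'k::{field,finite}) mpoly"
  assumes "r \<ge> 1" and "weighted_homogeneous w d f"
  shows "stack_count w f r = real (card (punctured_cone f (ext_field r)))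
    / real (card (ext_field r - {0} :: 'k alg_closure set))"
proof -
  let ?K = "ext_field r :: 'k alg_closure set"
  interpret finite_scalars ?K
    using assms(1) by (rule finite_scalars_ext_field)
  have "(\<Sum>\<xi>\<in>twists w f r. card \<xi>) = card (punctured_cone f ?K)"
    unfolding twists_def
    by (rule sum_card_weighted_orbits)
      (simp_all add: finite_punctured_cone finite_K
        weighted_orbit_subset_punctured_cone[OF finite_scalars_axioms assms(2)])
  moreover have "stack_count w f r = (\<Sum>\<xi>\<in>twists w f r. real (card \<xi>)) / real (card (?K - {0}))"
    by (simp add: stack_count_def mass_def mass_twist[OF assms(1)] sum_divide_distrib)
  ultimately show ?thesis
    by (simp flip: of_nat_sum)
qed

lemma stack_count_pos:
  fixes f :: "('n::finite, 'k::{field,finite}) mpoly"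
  assumes "r \<ge> 1" and "\<xi> \<in> twists w f r"
  shows "stack_count w f r > 0"
  unfolding stack_count_def mass_def
  using assms finite_twists card_twist_Aut_pos by (intro sum_pos) fastforce+

lemma measure_normalized_mass:
  fixes f :: "('n::finite, 'k::{field,finite}) mpoly"
  assumes "r \<ge> 1" and \<xi>: "\<xi> \<in> twists w f r"
  shows "measure (normalized_mass w f r) {\<xi>}
    = 1 / real (card (twist_Aut w r \<xi>)) / stack_count w f r"
proof -
  let ?M = "mass_measure w f r"
  let ?T = "twists w f r"
  have fin: "finite ?T"
    using assms(1) by (rule finite_twists)
  have em: "emeasure ?M A = ennreal (mass w r A)" if "A \<subseteq> ?T" for A
    using that fin
    by (simp add: mass_measure_def emeasure_point_measure_finite mass_def sum_nonneg)
  have "emeasure (normalized_mass w f r) {\<xi>} = emeasure ?M (?T \<inter> {\<xi>}) / emeasure ?M ?T"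
    unfolding normalized_mass_def
    using \<xi> by (intro emeasure_uniform_measure) (auto simp: mass_measure_def sets_point_measure)
  also have "\<dots> = ennreal (mass w r {\<xi>}) / ennreal (mass w r ?T)"
    using \<xi> by (simp add: em Int_absorb1)
  also have "\<dots> = ennreal (mass w r {\<xi>} / mass w r ?T)"
    using stack_count_pos[OF assms]
    by (intro divide_ennreal) (auto simp: stack_count_def mass_def)
  finally show ?thesis
    using stack_count_pos[OF assms]
    by (simp add: measure_def stack_count_def mass_def)
qed

section \<open>Height of a coarse point\<close>

lemma card_weighted_orbit_coarse_point:
  fixes f :: "('n::finite, 'k::{field,finite}) mpoly"
  assumes "r \<ge> 1" and "x \<in> coarse_points w f r" and "u \<in> x" and "v \<in> x"
  shows "card (weighted_orbit w (ext_field r) u) = card (weighted_orbit w (ext_field r) v)"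
proof -
  interpret finite_scalars "ext_field r :: 'k alg_closure set"
    using assms(1) by (rule finite_scalars_ext_field)
  obtain z where "x = weighted_orbit w UNIV z"
    using assms(2) by (auto simp: coarse_points_def)
  then obtain s t where "s \<noteq> 0" "t \<noteq> 0" "u = weighted_act w s z" "v = weighted_act w t z"
    using assms(3,4) by (auto simp: weighted_orbit_def)
  then show ?thesis
    by (simp add: card_weighted_orbit_translate)
qed

text \<open>
  The twist supplies a representative over the finite field, so that the description of the
  height determines a value.
\<close>

lemma prob_height_eq:
  fixes f :: "('n::finite, 'k::{field,finite}) mpoly"
  assumes "r \<ge> 1" and "weighted_homogeneous w d f" and x: "x \<in> coarse_points w f r"
    and \<xi>: "\<xi> \<in> twists w f r" and "lies_over \<xi> x"
  shows "prob_height w f r x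
    = - ln (real (card \<xi>) / real (card (punctured_cone f (ext_field r))))"
proof -
  let ?K = "ext_field r :: 'k alg_closure set"
  interpret finite_scalars ?K
    using assms(1) by (rule finite_scalars_ext_field)
  obtain v where v: "v \<in> punctured_cone f ?K" and \<xi>_eq: "\<xi> = weighted_orbit w ?K v"
    using \<xi> by (auto simp: twists_def)
  have "v \<in> x"
    using assms(5) self_in_weighted_orbit \<xi>_eq by (auto simp: lies_over_def)
  have card_eq: "card (weighted_orbit w ?K u) = card \<xi>" if "u \<in> x" for u
    unfolding \<xi>_eq by (rule card_weighted_orbit_coarse_point) (use assms that \<open>v \<in> x\<close> in auto)
  show ?thesis
    unfolding prob_height_def
    by (rule the_equality) (use card_eq v \<open>v \<in> x\<close> in auto)
qed

theorem proposition5p5: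
  fixes w :: "'n::finite \<Rightarrow> nat"
    and f :: "('n, 'k::{field,finite}) mpoly"
    and d r :: nat
    and \<xi> x :: "('k alg_closure ^ 'n) set"
  assumes "\<And>i. w i > 0"
    and "weighted_homogeneous w d f"
    and "r \<ge> 1"
    and "coarse_points w f r \<noteq> {}"
    and "x \<in> coarse_points w f r"
    and "\<xi> \<in> twists w f r"
    and "lies_over \<xi> x"
  shows "prob_height w f r x = - ln (measure (normalized_mass w f r) {\<xi>})
    \<and> - ln (measure (normalized_mass w f r) {\<xi>})
        = ln (stack_count w f r) + ln (real (card (twist_Aut w r \<xi>)))"
proof -
  let ?N = "card (ext_field r - {0} :: 'k alg_closure set)"
  let ?C = "card (punctured_cone f (ext_field r))"
  have N: "?N > 0"
    using finite_scalars.card_units_pos[OF finite_scalars_ext_field[OF assms(3)]] .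
  have p: "measure (normalized_mass w f r) {\<xi>}
      = 1 / real (card (twist_Aut w r \<xi>)) / stack_count w f r"
    using assms(3,6) by (rule measure_normalized_mass)
  also have "\<dots> = (real (card \<xi>) / real ?N) / (real ?C / real ?N)"
    by (simp only: mass_twist[OF assms(3,6)] total_mass[OF assms(3,2)])
  also have "\<dots> = real (card \<xi>) / real ?C"
    using N by simp
  finally have "prob_height w f r x = - ln (measure (normalized_mass w f r) {\<xi>})"
    using prob_height_eq[OF assms(3,2,5,6,7)] by simp
  moreover have "- ln (measure (normalized_mass w f r) {\<xi>})
      = ln (stack_count w f r) + ln (real (card (twist_Aut w r \<xi>)))"
    unfolding p
    using stack_count_pos[OF assms(3,6)] card_twist_Aut_pos[OF assms(3,6)]
    by (simp add: ln_div ln_mult)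
  ultimately show ?thesis
    by blast
qed

end
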